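(* Let $G$ and $H$ be finite simple graphs, not necessarily connected, without isolated vertices. Then their strong product $G\boxtimes H$ is DWR; that is, for every $k\in\mathbb{N}$ and all vertices $p,q$ of $G\boxtimes H$, whether there exists a walk of length $k$ from $p$ to $q$ depends only on $k$ and the distance between $p$ and $q$ in $G\boxtimes H$.
   Context: DWR (distance walk regular) means: for any two vertices $u,v$ of the graph and any $k\in\mathbb{N}$, the existence of a walk of length $k$ between $u$ and $v$ depends only on $k$ and on $d(u,v)$. Vertices in different components are at distance $\infty$. The strong product $G\boxtimes H$ has vertex set $V(G)\times V(H)$, and $(g_1,h_1)\sim(g_2,h_2)$ iff ($g_1\sim g_2$ and $h_1=h_2$) or ($g_1=g_2$ and $h_1\sim h_2$) or ($g_1\sim g_2$ and $h_1\sim h_2$). *)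

theory Defs
  imports "Graph_Theory.Pair_Digraph" "Graph_Theory.Shortest_Path"
begin

text \<open>
  Finite simple graphs are those of locale \<^locale>\<open>pair_graph\<close>: finite, symmetric and loopfree
  digraphs without parallel arcs, each undirected edge being a pair of opposite arcs.
\<close>

definition no_isolated_verts :: "'a pair_pre_digraph \<Rightarrow> bool" where
  "no_isolated_verts G \<longleftrightarrow> (\<forall>v \<in> pverts G. \<exists>w. (v, w) \<in> parcs G)"

definition strong_product ::
    "'a pair_pre_digraph \<Rightarrow> 'b pair_pre_digraph \<Rightarrow> ('a \<times> 'b) pair_pre_digraph"
    (infixr \<open>\<boxtimes>\<close> 70) where
  "G \<boxtimes> H = \<lparr> pverts = pverts G \<times> pverts H,
     parcs = {((g1, h1), (g2, h2)) | g1 h1 g2 h2.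
       g1 \<in> pverts G \<and> g2 \<in> pverts G \<and> h1 \<in> pverts H \<and> h2 \<in> pverts H \<and>
       ((g1, g2) \<in> parcs G \<and> h1 = h2 \<or>
        g1 = g2 \<and> (h1, h2) \<in> parcs H \<or>
        (g1, g2) \<in> parcs G \<and> (h1, h2) \<in> parcs H)} \<rparr>"

definition has_walk :: "'a pair_pre_digraph \<Rightarrow> nat \<Rightarrow> 'a \<Rightarrow> 'a \<Rightarrow> bool" where
  "has_walk G k u v \<longleftrightarrow> (\<exists>p. pre_digraph.awalk (with_proj G) u p v \<and> length p = k)"

text \<open>
  With unit weights the cost of a walk is its length; the infimum over the empty set makes the
  distance between vertices of different components \<open>\<infinity>\<close>.
\<close>

definition gdist :: "'a pair_pre_digraph \<Rightarrow> 'a \<Rightarrow> 'a \<Rightarrow> ereal" where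
  "gdist G u v = wf_digraph.\<mu> (with_proj G) (\<lambda>_. 1) u v"

definition DWR :: "'a pair_pre_digraph \<Rightarrow> bool" where
  "DWR G \<longleftrightarrow> (\<forall>k. \<forall>u \<in> pverts G. \<forall>v \<in> pverts G. \<forall>u' \<in> pverts G. \<forall>v' \<in> pverts G.
     gdist G u v = gdist G u' v' \<longrightarrow> has_walk G k u v = has_walk G k u' v')"

text \<open>
  The library's equation for \<open>\<mu>\<close> holds for well-formed digraphs only, so \<^const>\<open>gdist\<close> on a
  strong product relies on the following lemma.
\<close>

lemma pair_graph_strong_product:
  assumes "pair_graph G" "pair_graph H"
  shows "pair_graph (G \<boxtimes> H)"
proof -
  interpret G: pair_graph G by fact
  interpret H: pair_graph H by fact
  let ?P = "G \<boxtimes> H"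
  have sub: "parcs ?P \<subseteq> pverts ?P \<times> pverts ?P"
    by (auto simp: strong_product_def)
  have fin: "finite (pverts ?P)"
    by (simp add: strong_product_def G.pair_finite_verts H.pair_finite_verts)
  show ?thesis
  proof
    show "fst e \<in> pverts ?P" "snd e \<in> pverts ?P" if "e \<in> parcs ?P" for e
      using that sub by auto
    show "finite (pverts ?P)" by (rule fin)
    show "finite (parcs ?P)" using fin sub by (meson finite_SigmaI finite_subset)
    show "fst e \<noteq> snd e" if "e \<in> parcs ?P" for e
      using that G.pair_no_loops H.pair_no_loops by (fastforce simp: strong_product_def)
    show "Digraph.symmetric (with_proj ?P)"
      unfolding symmetric_def with_proj_simps
      by (rule symI) (auto simp: strong_product_def dest: G.arcs_symmetric H.arcs_symmetric)
  qed
qed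

end

theory Submission
  imports Defs
begin

text \<open>
  Suppose that every edge of a graph lies in a triangle. Then the first edge of a walk of length
  \<open>k \<ge> 1\<close> can be replaced by the other two sides of a triangle, so a walk of length \<open>k + 1\<close>
  with the same ends exists. Hence two vertices at finite distance \<open>d \<ge> 1\<close> are joined by walks of
  exactly the lengths \<open>k \<ge> d\<close>. A vertex is joined to itself by a walk of length \<open>0\<close>, by
  none of length \<open>1\<close>, and, if it has a neighbour, by walks of every length \<open>k \<ge> 2\<close>, since
  going to the neighbour and back is a walk of length \<open>2\<close>. Vertices at distance \<open>\<infinity>\<close> are joined
  by no walk. In each case only the distance matters (\<open>DWR_if_edges_in_triangles\<close>).

  In a strong product of graphs without isolated vertices every edge does lie in a triangle
  (\<open>strong_product_edge_in_triangle\<close>): a diagonal edge forms a triangle with a corner of its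
  square, and an edge inside a copy of one factor forms a triangle with a vertex in a neighbouring
  copy, which exists because the other factor has no isolated vertex.
\<close>

lemma has_walk_0_iff: "has_walk G 0 u v \<longleftrightarrow> u \<in> pverts G \<and> u = v"
  by (auto simp: has_walk_def pre_digraph.awalk_def pre_digraph.cas.simps cas_with_proj_eq
      awalk_verts_with_proj_eq)

lemma (in pair_wf_digraph) has_walk_Suc_iff:
  "has_walk G (Suc k) u v \<longleftrightarrow> (\<exists>w. (u, w) \<in> parcs G \<and> has_walk G k w v)"
proof
  assume "has_walk G (Suc k) u v"
  then show "\<exists>w. (u, w) \<in> parcs G \<and> has_walk G k w v"
    by (fastforce simp: has_walk_def length_Suc_conv awalk_Cons_iff)
next
  assume "\<exists>w. (u, w) \<in> parcs G \<and> has_walk G k w v"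
  then obtain w p where "(u, w) \<in> parcs G" "awalk w p v" "length p = k"
    by (auto simp: has_walk_def)
  then have "awalk u ((u, w) # p) v" "length ((u, w) # p) = Suc k"
    by (auto simp: awalk_Cons_iff)
  then show "has_walk G (Suc k) u v"
    unfolding has_walk_def by blast
qed

lemma (in pair_wf_digraph) gdist_eq_INF:
  "gdist G u v = (INF k \<in> {k. has_walk G k u v}. ereal (real k))"
proof -
  have "{k. has_walk G k u v} = length ` {p. awalk u p v}"
    by (auto simp: has_walk_def)
  then show ?thesis
    by (simp add: gdist_def \<mu>_def awalk_cost_def sum_list_triv image_image)
qed

lemma (in pair_wf_digraph) gdist_le_walk_length:
  "has_walk G k u v \<Longrightarrow> gdist G u v \<le> ereal (real k)"
  by (auto simp: gdist_eq_INF intro: INF_lower)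

text \<open>
  Lengths of walks are natural numbers, so their infimum is attained unless there is no walk.
\<close>

lemma (in pair_wf_digraph) walk_of_length_gdist:
  assumes "gdist G u v \<noteq> \<infinity>"
  obtains d where "has_walk G d u v" "gdist G u v = ereal (real d)"
proof -
  have "{k. has_walk G k u v} \<noteq> {}"
  proof
    assume "{k. has_walk G k u v} = {}"
    then show False using assms by (simp add: gdist_eq_INF top_ereal_def)
  qed
  then have least: "has_walk G (LEAST k. has_walk G k u v) u v"
    by (auto intro: LeastI)
  moreover have "gdist G u v = ereal (real (LEAST k. has_walk G k u v))"
  proof (rule antisym)
    show "gdist G u v \<le> ereal (real (LEAST k. has_walk G k u v))"
      by (rule gdist_le_walk_length[OF least])
    show "ereal (real (LEAST k. has_walk G k u v)) \<le> gdist G u v"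
      unfolding gdist_eq_INF by (rule INF_greatest) (simp add: Least_le)
  qed
  ultimately show thesis by (rule that)
qed

text \<open>
  The walk is lengthened by replacing its first edge by the other two sides of a triangle; the bound
  \<open>1 \<le> m\<close> provides that edge.
\<close>

lemma (in pair_wf_digraph) longer_walk_if_edges_in_triangles:
  assumes triangle: "\<And>x y. (x, y) \<in> parcs G \<Longrightarrow> \<exists>z. (x, z) \<in> parcs G \<and> (z, y) \<in> parcs G"
    and "has_walk G m u v" "1 \<le> m" "m \<le> k"
  shows "has_walk G k u v"
  using \<open>m \<le> k\<close>
proof (induction k rule: dec_induct)
  case base
  show ?case by fact
next
  case (step n)
  then obtain n' where n: "n = Suc n'"
    using \<open>1 \<le> m\<close> by (cases n) auto
  then obtain y where y: "(u, y) \<in> parcs G" "has_walk G n' y v"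
    using step.IH by (auto simp: has_walk_Suc_iff)
  obtain z where "(u, z) \<in> parcs G" "(z, y) \<in> parcs G"
    using triangle[OF y(1)] by blast
  then show ?case
    using y(2) unfolding n has_walk_Suc_iff by blast
qed

text \<open>
  Distance \<open>0\<close> is the only case in which lengths \<open>k \<ge> d\<close> can fail to occur: lengthening starts from
  a walk with an edge, and the shortest such closed walk goes to a neighbour and back. Without a
  neighbour at every vertex, an isolated vertex and one with neighbours would both be at distance
  \<open>0\<close> from themselves, but only the latter would have closed walks of length \<open>2\<close>.
\<close>

lemma (in pair_graph) DWR_if_edges_in_triangles:
  assumes triangle: "\<And>x y. (x, y) \<in> parcs G \<Longrightarrow> \<exists>z. (x, z) \<in> parcs G \<and> (z, y) \<in> parcs G"
    and "no_isolated_verts G"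
  shows "DWR G"
proof -
  \<comment> \<open>The hypotheses are symmetric in the two pairs of vertices, so one implication suffices.\<close>
  have transfer: "has_walk G k u' v'"
    if verts: "u' \<in> pverts G"
      and eq: "gdist G u v = gdist G u' v'" and walk: "has_walk G k u v" for k u v u' v'
  proof -
    have le: "gdist G u' v' \<le> ereal (real k)"
      using gdist_le_walk_length[OF walk] eq by simp
    then obtain d where d: "has_walk G d u' v'" "gdist G u' v' = ereal (real d)"
    proof -
      have "gdist G u' v' \<noteq> \<infinity>" using le by auto
      then show thesis by (rule walk_of_length_gdist) (rule that)
    qed
    with le have "d \<le> k" by simp
    show ?thesis
    proof (cases "d = 0")
      case False
      with d(1) \<open>d \<le> k\<close> show ?thesis
        by (intro longer_walk_if_edges_in_triangles[of d u' v' k] triangle) simp_all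
    next
      case True
      have "u = v"
      proof -
        have "gdist G u v \<noteq> \<infinity>" "gdist G u v = 0" using True d(2) eq by auto
        then obtain e where "has_walk G e u v" "e = 0"
          using walk_of_length_gdist[of u v] by force
        then show ?thesis by (simp add: has_walk_0_iff)
      qed
      have "u' = v'"
        using True d(1) by (simp add: has_walk_0_iff)
      consider "k = 0" | "k = 1" | "2 \<le> k" by linarith
      then show ?thesis
      proof cases
        case 1
        then show ?thesis using True d(1) by simp
      next
        case 2
        \<comment> \<open>A closed walk of length \<open>1\<close> would be a loop.\<close>
        then show ?thesis
          using walk \<open>u = v\<close> pair_no_loops[of "(u, u)"]
          by (auto simp: has_walk_Suc_iff has_walk_0_iff)
      next
        case 3
        obtain w where "(u', w) \<in> parcs G"
          using verts \<open>no_isolated_verts G\<close> by (auto simp: no_isolated_verts_def)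
        moreover have "(w, u') \<in> parcs G"
          using calculation by (rule arcs_symmetric)
        ultimately have "has_walk G 2 u' v'"
          using verts \<open>u' = v'\<close> by (auto simp: numeral_2_eq_2 has_walk_Suc_iff has_walk_0_iff)
        then show ?thesis
          using 3 by (intro longer_walk_if_edges_in_triangles[of 2 u' v' k] triangle) simp_all
      qed
    qed
  qed
  show ?thesis
    unfolding DWR_def
  proof (intro allI ballI impI)
    fix k u v u' v'
    assume "u \<in> pverts G" "u' \<in> pverts G" and eq: "gdist G u v = gdist G u' v'"
    then show "has_walk G k u v = has_walk G k u' v'"
      using transfer[OF _ eq] transfer[OF _ eq[symmetric]] by blast
  qed
qed

lemma strong_product_arc_iff:
  "((g1, h1), (g2, h2)) \<in> parcs (G \<boxtimes> H) \<longleftrightarrow>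
     g1 \<in> pverts G \<and> g2 \<in> pverts G \<and> h1 \<in> pverts H \<and> h2 \<in> pverts H \<and>
     ((g1, g2) \<in> parcs G \<and> h1 = h2 \<or> g1 = g2 \<and> (h1, h2) \<in> parcs H \<or>
      (g1, g2) \<in> parcs G \<and> (h1, h2) \<in> parcs H)"
  by (simp add: strong_product_def)

text \<open>
  If \<open>g1\<close>, \<open>g2\<close> are adjacent and \<open>h\<close> is a neighbour of \<open>h1\<close>, then \<open>(g1, h)\<close> is adjacent
  to \<open>(g1, h1)\<close> within a copy of \<open>H\<close> and to \<open>(g2, h1)\<close> diagonally. This is where isolated
  vertices in a factor could leave edges outside triangles.
\<close>

lemma strong_product_edge_in_triangle:
  assumes "pair_graph G" "pair_graph H" "no_isolated_verts G" "no_isolated_verts H"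
    and arc: "(x, y) \<in> parcs (G \<boxtimes> H)"
  shows "\<exists>z. (x, z) \<in> parcs (G \<boxtimes> H) \<and> (z, y) \<in> parcs (G \<boxtimes> H)"
proof -
  interpret G: pair_graph G by fact
  interpret H: pair_graph H by fact
  obtain g1 h1 g2 h2 where xy: "x = (g1, h1)" "y = (g2, h2)"
    by (cases x; cases y) auto
  have verts: "g1 \<in> pverts G" "g2 \<in> pverts G" "h1 \<in> pverts H" "h2 \<in> pverts H"
    using arc by (auto simp: xy strong_product_arc_iff)
  obtain g where g: "(g1, g) \<in> parcs G"
    using verts assms(3) by (auto simp: no_isolated_verts_def)
  note g = g G.arcs_symmetric[OF g] G.in_arcsD2[OF g]
  obtain h where h: "(h1, h) \<in> parcs H"
    using verts assms(4) by (auto simp: no_isolated_verts_def)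
  note h = h H.arcs_symmetric[OF h] H.in_arcsD2[OF h]
  consider "(g1, g2) \<in> parcs G" "h1 = h2" | "g1 = g2" "(h1, h2) \<in> parcs H"
    | "(g1, g2) \<in> parcs G" "(h1, h2) \<in> parcs H"
    using arc by (auto simp: xy strong_product_arc_iff)
  then show ?thesis
  proof cases
    case 1
    then show ?thesis
      using verts h by (intro exI[of _ "(g1, h)"]) (auto simp: xy strong_product_arc_iff)
  next
    case 2
    then show ?thesis
      using verts g by (intro exI[of _ "(g, h1)"]) (auto simp: xy strong_product_arc_iff)
  next
    case 3
    then show ?thesis
      using verts by (intro exI[of _ "(g1, h2)"]) (auto simp: xy strong_product_arc_iff)
  qed
qed

lemma strong_product_no_isolated_verts:
  assumes "pair_graph G" "no_isolated_verts G"
  shows "no_isolated_verts (G \<boxtimes> H)"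
proof -
  interpret pair_graph G by fact
  show ?thesis
    unfolding no_isolated_verts_def
  proof
    fix x assume "x \<in> pverts (G \<boxtimes> H)"
    then obtain g h where x: "x = (g, h)" "g \<in> pverts G" "h \<in> pverts H"
      by (auto simp: strong_product_def)
    then obtain g' where g': "(g, g') \<in> parcs G"
      using assms(2) by (auto simp: no_isolated_verts_def)
    have "(x, (g', h)) \<in> parcs (G \<boxtimes> H)"
      using x g' in_arcsD2[OF g'] by (simp add: strong_product_arc_iff)
    then show "\<exists>y. (x, y) \<in> parcs (G \<boxtimes> H)" ..
  qed
qed

theorem theorem5p6:
  fixes G :: "'a pair_pre_digraph" and H :: "'b pair_pre_digraph"
  assumes "pair_graph G" and "pair_graph H"
    and "no_isolated_verts G" and "no_isolated_verts H"
  shows "DWR (G \<boxtimes> H)"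
  by (intro pair_graph.DWR_if_edges_in_triangles pair_graph_strong_product
      strong_product_edge_in_triangle strong_product_no_isolated_verts assms)

end
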